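(* Let $X,Y$ be normed spaces, $F\colon X\rightrightarrows Y$ a set-valued mapping, $\phi\colon X\times Y\to\mathbb R$ a function, and let $\mu(x):=\inf\{\phi(x,y)\mid y\in F(x)\}$ for $x\in X$. Suppose that $\phi$ is Lipschitz continuous on $X\times Y$ and that $F$ is Lipschitz continuous on $X$. Then $\mu$ is Lipschitz continuous on the set $\{x\in X\mid\mu(x)\in\mathbb R\}$.
   Context: $\inf\emptyset=\infty$. The product $X\times Y$ carries the norm $\|(x,y)\|=\|x\|+\|y\|$. A function $f$ is Lipschitz continuous on a set $\Omega$ on which it is finite if there is $\ell\ge0$ with $|f(x)-f(u)|\le\ell\|x-u\|$ for all $x,u\in\Omega$. The set-valued mapping $F$ is (Hausdorff) Lipschitz continuous on $X$ if there is $\ell\ge0$ with $F(u)\subset F(x)+\ell\|x-u\|\mathbb B_Y$ for all $x,u\in X$, where $\mathbb B_Y$ is the closed unit ball of $Y$. *)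

theory Defs
  imports "HOL-Analysis.Analysis"
begin

text \<open>The library's norm on a product type is the Euclidean combination of the two norms;
  here the product carries the sum norm, so Lipschitz continuity below takes the norm
  of the domain as an explicit argument.\<close>

definition sum_norm :: "'a::real_normed_vector \<times> 'b::real_normed_vector \<Rightarrow> real" where
  "sum_norm p = norm (fst p) + norm (snd p)"

definition lipschitz_cont_on ::
    "('a::ab_group_add \<Rightarrow> real) \<Rightarrow> 'a set \<Rightarrow> ('a \<Rightarrow> ereal) \<Rightarrow> bool" where
  "lipschitz_cont_on N \<Omega> f \<longleftrightarrow>
     (\<forall>x\<in>\<Omega>. f x \<in> range ereal) \<and>
     (\<exists>l\<ge>0. \<forall>x\<in>\<Omega>. \<forall>u\<in>\<Omega>. \<bar>f x - f u\<bar> \<le> ereal (l * N (x - u)))"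

definition set_lipschitz_cont ::
    "('a::real_normed_vector \<Rightarrow> 'b::real_normed_vector set) \<Rightarrow> bool" where
  "set_lipschitz_cont F \<longleftrightarrow>
     (\<exists>l\<ge>0. \<forall>x u. F u \<subseteq> {y + (l * norm (x - u)) *\<^sub>R b | y b. y \<in> F x \<and> b \<in> cball 0 1})"

text \<open>The infimum is taken in the extended reals, so it is \<open>\<infinity>\<close> where \<open>F x\<close> is empty.\<close>

definition marginal :: "('a \<times> 'b \<Rightarrow> real) \<Rightarrow> ('a \<Rightarrow> 'b set) \<Rightarrow> 'a \<Rightarrow> ereal" where
  "marginal \<phi> F x = (INF y\<in>F x. ereal (\<phi> (x, y)))"

end

theory Submission
  imports Defs
begin

text \<open>Let \<open>l\<close> and \<open>k\<close> be Lipschitz constants of \<open>\<phi>\<close> and \<open>F\<close>. A point \<open>v\<close> that competes in the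
  infimum at \<open>u\<close> can be moved to a competitor \<open>y\<close> at \<open>x\<close> with \<open>norm (y - v) \<le> k * norm (x - u)\<close>, and
  passing from \<open>(u, v)\<close> to \<open>(x, y)\<close> raises \<open>\<phi>\<close> by at most
  \<open>l * (norm (x - u) + norm (y - v)) \<le> l * (1 + k) * norm (x - u)\<close>. Taking the infimum over \<open>v\<close> yields
  the one-sided estimate \<open>marginal_le_marginal_plus\<close>. It holds in the extended reals for all \<open>x\<close> and
  \<open>u\<close>; where both values are finite, exchanging \<open>x\<close> and \<open>u\<close> turns it into the Lipschitz
  estimate with constant \<open>l * (1 + k)\<close>.\<close>

lemma set_lipschitz_contE:
  assumes "set_lipschitz_cont F"
  obtains k where "k \<ge> 0"
    and "\<And>x u v. v \<in> F u \<Longrightarrow> \<exists>y\<in>F x. norm (y - v) \<le> k * norm (x - u)"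
proof -
  obtain k where k: "k \<ge> 0"
    and sub: "\<And>x u. F u \<subseteq> {y + (k * norm (x - u)) *\<^sub>R b | y b. y \<in> F x \<and> b \<in> cball 0 1}"
    using assms unfolding set_lipschitz_cont_def by blast
  have "\<exists>y\<in>F x. norm (y - v) \<le> k * norm (x - u)" if mem: "v \<in> F u" for x u v
  proof -
    obtain y b where y: "y \<in> F x" and b: "norm b \<le> 1" and v: "v = y + (k * norm (x - u)) *\<^sub>R b"
      using subsetD[OF sub mem, of x] by auto
    have "norm (y - v) = k * norm (x - u) * norm b"
      using k v by simp
    also have "\<dots> \<le> k * norm (x - u)"
      using b k by (simp add: mult_left_le)
    finally show ?thesis using y by blast
  qed
  with k show thesis by (rule that)
qed

text \<open>The constant is moved to the left-hand side, so that the infimum at \<open>u\<close> need only be compared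
  with a lower bound; when \<open>F u\<close> is empty that infimum is \<open>\<infinity>\<close> and there is nothing to compare.\<close>

lemma marginal_le_marginal_plus:
  fixes \<phi> :: "'a::real_normed_vector \<times> 'b::real_normed_vector \<Rightarrow> real"
  assumes "l \<ge> 0"
    and \<phi>: "\<And>p q. \<bar>\<phi> p - \<phi> q\<bar> \<le> l * sum_norm (p - q)"
    and F: "\<And>v. v \<in> F u \<Longrightarrow> \<exists>y\<in>F x. norm (y - v) \<le> k * norm (x - u)"
  shows "marginal \<phi> F x \<le> marginal \<phi> F u + ereal (l * (1 + k) * norm (x - u))"
proof -
  let ?C = "l * (1 + k) * norm (x - u)"
  have "marginal \<phi> F x - ereal ?C \<le> ereal (\<phi> (u, v))" if v: "v \<in> F u" for v
  proof -
    obtain y where y: "y \<in> F x" "norm (y - v) \<le> k * norm (x - u)"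
      using F[OF v] by blast
    have "\<phi> (x, y) - \<phi> (u, v) \<le> l * (norm (x - u) + norm (y - v))"
      using \<phi>[of "(x, y)" "(u, v)"] by (simp add: sum_norm_def)
    also have "\<dots> \<le> l * (norm (x - u) + k * norm (x - u))"
      using y \<open>l \<ge> 0\<close> by (intro mult_left_mono) auto
    finally have "\<phi> (x, y) \<le> \<phi> (u, v) + ?C"
      by (simp add: algebra_simps)
    moreover have "marginal \<phi> F x \<le> ereal (\<phi> (x, y))"
      unfolding marginal_def using y by (intro INF_lower)
    ultimately have "marginal \<phi> F x \<le> ereal (\<phi> (u, v)) + ereal ?C"
      by (simp add: order_trans[of _ "ereal (\<phi> (x, y))"])
    then show ?thesis
      by (simp add: ereal_minus_le)
  qed
  then have "marginal \<phi> F x - ereal ?C \<le> marginal \<phi> F u"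
    unfolding marginal_def[of \<phi> F u] by (intro INF_greatest)
  then show ?thesis
    by (simp add: ereal_minus_le)
qed

theorem theorem4p9:
  fixes F :: "'a::real_normed_vector \<Rightarrow> 'b::real_normed_vector set"
    and \<phi> :: "'a \<times> 'b \<Rightarrow> real"
  assumes "lipschitz_cont_on sum_norm UNIV (\<lambda>p. ereal (\<phi> p))"
    and "set_lipschitz_cont F"
  shows "lipschitz_cont_on norm {x. marginal \<phi> F x \<in> range ereal} (marginal \<phi> F)"
proof -
  obtain l where l: "l \<ge> 0" and \<phi>: "\<And>p q. \<bar>\<phi> p - \<phi> q\<bar> \<le> l * sum_norm (p - q)"
    using assms(1) unfolding lipschitz_cont_on_def by auto
  obtain k where k: "k \<ge> 0"
    and F: "\<And>x u v. v \<in> F u \<Longrightarrow> \<exists>y\<in>F x. norm (y - v) \<le> k * norm (x - u)"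
    using assms(2) by (rule set_lipschitz_contE) blast
  have le: "marginal \<phi> F x \<le> marginal \<phi> F u + ereal (l * (1 + k) * norm (x - u))" for x u
    using l \<phi> F by (rule marginal_le_marginal_plus)
  have "\<bar>marginal \<phi> F x - marginal \<phi> F u\<bar> \<le> ereal (l * (1 + k) * norm (x - u))"
    if fin: "marginal \<phi> F x \<in> range ereal" "marginal \<phi> F u \<in> range ereal" for x u
  proof -
    obtain r s where "marginal \<phi> F x = ereal r" "marginal \<phi> F u = ereal s"
      using fin by blast
    then show ?thesis
      using le[of x u] le[of u x] by (auto simp: norm_minus_commute)
  qed
  moreover have "l * (1 + k) \<ge> 0"
    using l k by simp
  ultimately show ?thesis
    unfolding lipschitz_cont_on_def by blast
qed

end
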